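(* Assume that Dydak's Unique Path-Lifting Problem has an affirmative answer, i.e. that for every non-empty connected, locally path-connected space $E'$, every map $E'\to D^2$ with the path-covering property is a homeomorphism. Let $E$ and $X$ be non-empty path-connected spaces, $e_0\in E$, and let $p:E\to X$ have the path-covering property, where $X$ is first countable, locally path-connected, and semilocally simply connected, and $ev_1:P(E,e_0)\to E$ is a topological quotient map. Then $p$ is a covering projection.
   Context: Maps are continuous. $D^2$ is the closed unit disk in $\mathbb{R}^2$. $P(Y,y)$ is the space of paths $\alpha:[0,1]\to Y$ with $\alpha(0)=y$, with the compact-open topology, and $ev_1:P(Y,y)\to Y$ is $ev_1(\alpha)=\alpha(1)$. A map $p:E\to X$ has the path-covering property if for every $e\in E$ the induced map $P(E,e)\to P(X,p(e))$, $\alpha\mapsto p\circ\alpha$, is a bijection. *)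

theory Defs
  imports "HOL-Analysis.Analysis"
begin

text \<open>
  Spaces are abstract topologies; the points of a space \<open>X\<close> are the elements of
  \<open>topspace X\<close>.  Paths are total functions on the reals, so they are normalised to be
  extensional outside the unit interval: equality of paths is then equality of functions, and
  composition with a map has to be restricted to the unit interval again.
\<close>

definition paths_from :: "'a topology \<Rightarrow> 'a \<Rightarrow> (real \<Rightarrow> 'a) set" where
  "paths_from X x = {\<alpha>. pathin X \<alpha> \<and> \<alpha> \<in> extensional {0..1} \<and> \<alpha> 0 = x}"

definition path_space :: "'a topology \<Rightarrow> 'a \<Rightarrow> (real \<Rightarrow> 'a) topology" where
  "path_space X x = topology_generated_by
     {{\<alpha> \<in> paths_from X x. \<alpha> ` K \<subseteq> U} | K U. compact K \<and> K \<subseteq> {0..1} \<and> openin X U}"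

definition path_covering :: "'a topology \<Rightarrow> 'b topology \<Rightarrow> ('a \<Rightarrow> 'b) \<Rightarrow> bool" where
  "path_covering E X p \<longleftrightarrow>
     continuous_map E X p \<and>
     (\<forall>e \<in> topspace E.
        bij_betw (\<lambda>\<alpha>. restrict (p \<circ> \<alpha>) {0..1}) (paths_from E e) (paths_from X (p e)))"

definition semilocally_simply_connected :: "'a topology \<Rightarrow> bool" where
  "semilocally_simply_connected X \<longleftrightarrow>
     (\<forall>x \<in> topspace X. \<exists>U. openin X U \<and> x \<in> U \<and>
        (\<forall>\<alpha>. pathin (subtopology X U) \<alpha> \<and> \<alpha> 0 = x \<and> \<alpha> 1 = x \<longrightarrow>
           homotopic_with (\<lambda>\<beta>. \<beta> 0 = x \<and> \<beta> 1 = x) (top_of_set {0..1}) X \<alpha> (\<lambda>t. x)))"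

text \<open>The analogue of \<^const>\<open>covering_space\<close> for abstract topologies.\<close>

definition covering_projection :: "'a topology \<Rightarrow> 'b topology \<Rightarrow> ('a \<Rightarrow> 'b) \<Rightarrow> bool" where
  "covering_projection E X p \<longleftrightarrow>
     continuous_map E X p \<and> p ` topspace E = topspace X \<and>
     (\<forall>x \<in> topspace X. \<exists>U. x \<in> U \<and> openin X U \<and>
        (\<exists>\<V>. \<Union>\<V> = {e \<in> topspace E. p e \<in> U} \<and>
              (\<forall>V \<in> \<V>. openin E V) \<and> pairwise disjnt \<V> \<and>
              (\<forall>V \<in> \<V>. homeomorphic_map (subtopology E V) (subtopology X U) p)))"

lemma covering_projection_top_of_set:
  "covering_projection (top_of_set S) (top_of_set T) p \<longleftrightarrow> covering_space S p T"
proof -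
  have hom: "homeomorphic_map (top_of_set V) (top_of_set U) p \<longleftrightarrow> (\<exists>q. homeomorphism V U p q)" for V U
  proof -
    have "homeomorphic_maps (top_of_set V) (top_of_set U) p q \<longleftrightarrow> homeomorphism V U p q" for q
    proof
      assume "homeomorphic_maps (top_of_set V) (top_of_set U) p q"
      then have *: "continuous_on V p" "p ` V \<subseteq> U" "continuous_on U q" "q ` U \<subseteq> V"
        "\<And>x. x \<in> V \<Longrightarrow> q (p x) = x" "\<And>y. y \<in> U \<Longrightarrow> p (q y) = y"
        by (auto simp: homeomorphic_maps_def continuous_map_in_subtopology)
      show "homeomorphism V U p q" by (rule homeomorphismI) (use * in auto)
    next
      assume "homeomorphism V U p q"
      then show "homeomorphic_maps (top_of_set V) (top_of_set U) p q"
        by (auto simp: homeomorphic_maps_def homeomorphism_def continuous_map_in_subtopology)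
    qed
    then show ?thesis by (simp add: homeomorphic_map_maps)
  qed
  have *: "(\<forall>V\<in>\<V>. homeomorphic_map (subtopology (top_of_set S) V) (subtopology (top_of_set T) U) p)
      \<longleftrightarrow> (\<forall>V\<in>\<V>. \<exists>q. homeomorphism V U p q)"
    if "openin (top_of_set T) U" "\<forall>V\<in>\<V>. openin (top_of_set S) V" for U \<V>
  proof (rule ball_cong[OF refl])
    fix V assume "V \<in> \<V>"
    then have "V \<subseteq> S" "U \<subseteq> T"
      using that openin_imp_subset by blast+
    then show "homeomorphic_map (subtopology (top_of_set S) V) (subtopology (top_of_set T) U) p
        \<longleftrightarrow> (\<exists>q. homeomorphism V U p q)"
      using hom by (simp add: subtopology_subtopology Int_absorb1)
  qed
  have **: "{e \<in> S. p e \<in> U} = S \<inter> p -` U" for U by auto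
  have base: "continuous_map (top_of_set S) (top_of_set T) p \<and> p ` S = T \<and> R \<longleftrightarrow>
      continuous_on S p \<and> p ` S = T \<and> R" for R
    by (auto simp: continuous_map_in_subtopology)
  show ?thesis
    unfolding covering_projection_def covering_space_def topspace_euclidean_subtopology ** base
    by (simp only: * cong: conj_cong)
qed

text \<open>
  An affirmative answer to the Unique Path-Lifting Problem, for spaces whose points are elements
  of the type \<open>'e\<close>.  HOL cannot quantify over all types inside a formula, but the type
  \<open>real \<Rightarrow> real^2\<close> is large enough for every possible total space:
  if \<open>E'\<close> is path-connected, then sending a point to the image of a path leading to it embeds
  \<open>E'\<close> into the set of paths of the disk.  Lemma \<open>upl_affirmative_any_type\<close> records this, so
  \<open>upl_affirmative TYPE(real \<Rightarrow> real^2)\<close> is the statement about all spaces.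
\<close>

definition upl_affirmative :: "'e itself \<Rightarrow> bool" where
  "upl_affirmative _ \<longleftrightarrow>
     (\<forall>(E' :: 'e topology) (q :: 'e \<Rightarrow> real^2).
        topspace E' \<noteq> {} \<and> connected_space E' \<and> locally_path_connected_space E' \<and>
        path_covering E' (top_of_set (cball 0 1)) q \<longrightarrow>
        homeomorphic_map E' (top_of_set (cball 0 1)) q)"

lemma paths_from_compose:
  assumes "continuous_map X Y f" "\<alpha> \<in> paths_from X x"
  shows "restrict (f \<circ> \<alpha>) {0..1} \<in> paths_from Y (f x)"
proof -
  have "pathin Y (f \<circ> \<alpha>)"
    using assms(2) by (intro pathin_compose[OF _ assms(1)]) (simp add: paths_from_def)
  then have "pathin Y (restrict (f \<circ> \<alpha>) {0..1})"
    unfolding pathin_def by (rule continuous_map_eq) auto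
  then show ?thesis using assms(2) by (simp add: paths_from_def)
qed

lemma paths_from_topspace:
  "\<alpha> \<in> paths_from X x \<Longrightarrow> t \<in> {0..1} \<Longrightarrow> \<alpha> t \<in> topspace X"
  unfolding paths_from_def pathin_def continuous_map_def by auto

lemma paths_from_inverse:
  assumes "\<And>x. x \<in> topspace X \<Longrightarrow> g (f x) = x" "\<alpha> \<in> paths_from X x"
  shows "restrict (g \<circ> restrict (f \<circ> \<alpha>) {0..1}) {0..1} = \<alpha>"
proof
  fix t
  show "restrict (g \<circ> restrict (f \<circ> \<alpha>) {0..1}) {0..1} t = \<alpha> t"
    using assms paths_from_topspace[OF assms(2), of t]
    by (auto simp: paths_from_def extensional_def)
qed

lemma path_covering_homeomorphic_maps:
  assumes "homeomorphic_maps X Y f g"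
  shows "path_covering X Y f"
  unfolding path_covering_def
proof (intro conjI ballI)
  show f: "continuous_map X Y f" using assms by (simp add: homeomorphic_maps_def)
  have g: "continuous_map Y X g" using assms by (simp add: homeomorphic_maps_def)
  have gf: "\<And>x. x \<in> topspace X \<Longrightarrow> g (f x) = x" and fg: "\<And>y. y \<in> topspace Y \<Longrightarrow> f (g y) = y"
    using assms by (auto simp: homeomorphic_maps_def)
  fix x assume x: "x \<in> topspace X"
  show "bij_betw (\<lambda>\<alpha>. restrict (f \<circ> \<alpha>) {0..1}) (paths_from X x) (paths_from Y (f x))"
  proof (rule bij_betw_byWitness[where f' = "\<lambda>\<alpha>. restrict (g \<circ> \<alpha>) {0..1}"])
    show "\<forall>\<alpha>\<in>paths_from X x. restrict (g \<circ> restrict (f \<circ> \<alpha>) {0..1}) {0..1} = \<alpha>"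
      using paths_from_inverse[of X g f] gf by blast
    show "\<forall>\<alpha>\<in>paths_from Y (f x). restrict (f \<circ> restrict (g \<circ> \<alpha>) {0..1}) {0..1} = \<alpha>"
      using paths_from_inverse[of Y f g] fg by blast
    show "(\<lambda>\<alpha>. restrict (f \<circ> \<alpha>) {0..1}) ` paths_from X x \<subseteq> paths_from Y (f x)"
      using paths_from_compose[OF f] by blast
    show "(\<lambda>\<alpha>. restrict (g \<circ> \<alpha>) {0..1}) ` paths_from Y (f x) \<subseteq> paths_from X x"
      using paths_from_compose[OF g] gf[OF x] by fastforce
  qed
qed

lemma path_covering_compose:
  assumes "path_covering X Y f" "path_covering Y Z g"
  shows "path_covering X Z (g \<circ> f)"
  unfolding path_covering_def
proof (intro conjI ballI)
  show "continuous_map X Z (g \<circ> f)"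
    using assms continuous_map_compose unfolding path_covering_def by blast
  fix x assume x: "x \<in> topspace X"
  then have fx: "f x \<in> topspace Y"
    using assms by (auto simp: path_covering_def continuous_map_def)
  have "bij_betw ((\<lambda>\<alpha>. restrict (g \<circ> \<alpha>) {0..1}) \<circ> (\<lambda>\<alpha>. restrict (f \<circ> \<alpha>) {0..1}))
          (paths_from X x) (paths_from Z (g (f x)))"
    using assms x fx unfolding path_covering_def by (blast intro: bij_betw_trans)
  moreover have "(\<lambda>\<alpha>. restrict (g \<circ> \<alpha>) {0..1}) \<circ> (\<lambda>\<alpha>. restrict (f \<circ> \<alpha>) {0..1::real})
      = (\<lambda>\<alpha>. restrict (g \<circ> f \<circ> \<alpha>) {0..1})"
    by (auto simp: fun_eq_iff)
  ultimately show "bij_betw (\<lambda>\<alpha>. restrict (g \<circ> f \<circ> \<alpha>) {0..1})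
      (paths_from X x) (paths_from Z ((g \<circ> f) x))" by simp
qed

lemma upl_affirmative_any_type:
  assumes "upl_affirmative TYPE(real \<Rightarrow> real^2)"
  shows "upl_affirmative TYPE('e)"
  unfolding upl_affirmative_def
proof (intro allI impI, elim conjE)
  fix E' :: "'e topology" and q :: "'e \<Rightarrow> real^2"
  let ?D = "top_of_set (cball 0 1) :: (real^2) topology"
  assume ne: "topspace E' \<noteq> {}" and conn: "connected_space E'"
    and lpc: "locally_path_connected_space E'" and q: "path_covering E' ?D q"
  obtain e0 where e0: "e0 \<in> topspace E'" using ne by blast
  have "path_connected_space E'"
    using conn lpc path_connected_eq_connected_space by blast
  then have "\<exists>\<alpha>. \<alpha> \<in> paths_from E' e0 \<and> \<alpha> 1 = e" if "e \<in> topspace E'" for e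
  proof -
    obtain g where g: "pathin E' g" "g 0 = e0" "g 1 = e"
      using \<open>path_connected_space E'\<close> e0 \<open>e \<in> topspace E'\<close>
      unfolding path_connected_space_def by blast
    have "pathin E' (restrict g {0..1})"
      using g(1) unfolding pathin_def by (rule continuous_map_eq) auto
    then show ?thesis
      using g by (intro exI[of _ "restrict g {0..1}"]) (auto simp: paths_from_def)
  qed
  then obtain A where A: "\<And>e. e \<in> topspace E' \<Longrightarrow> A e \<in> paths_from E' e0 \<and> A e 1 = e"
    by metis
  define J where "J = (\<lambda>e. restrict (q \<circ> A e) {0..1})"
  have J: "inj_on J (topspace E')"
  proof (rule inj_onI)
    fix a b assume ab: "a \<in> topspace E'" "b \<in> topspace E'" "J a = J b"
    have "inj_on (\<lambda>\<alpha>. restrict (q \<circ> \<alpha>) {0..1}) (paths_from E' e0)"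
      using q e0 by (auto simp: path_covering_def bij_betw_def)
    then have "A a = A b" using ab A unfolding J_def by (meson inj_onD)
    then show "a = b" using A ab by metis
  qed
  define g where "g = inv_into (topspace E') J"
  define F where "F = pullback_topology (J ` topspace E') g E'"
  have gJ: "g (J e) = e" if "e \<in> topspace E'" for e
    using that J by (simp add: g_def)
  have topF: "topspace F = J ` topspace E'"
    using gJ by (auto simp: F_def topspace_pullback_topology)
  have "continuous_map F E' g"
    unfolding F_def using continuous_map_pullback[OF continuous_map_id, where f = g] by simp
  moreover have "continuous_map E' F J"
    unfolding F_def
  proof (rule continuous_map_pullback')
    show "continuous_map E' E' (g \<circ> J)"
      by (rule continuous_map_eq[OF continuous_map_id]) (simp add: gJ)
    show "topspace E' \<subseteq> J -` J ` topspace E'" by auto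
  qed
  ultimately have hom: "homeomorphic_maps F E' g J"
    using gJ topF by (auto simp: homeomorphic_maps_def)
  then have hs: "E' homeomorphic_space F"
    using homeomorphic_maps_sym unfolding homeomorphic_space_def by blast
  have "path_covering F ?D (q \<circ> g)"
    using path_covering_compose[OF path_covering_homeomorphic_maps[OF hom] q] .
  moreover have "connected_space F" "locally_path_connected_space F" "topspace F \<noteq> {}"
    using conn lpc ne hs homeomorphic_connected_space homeomorphic_locally_path_connected_space
      topF by blast+
  ultimately have "homeomorphic_map F ?D (q \<circ> g)"
    using assms unfolding upl_affirmative_def by blast
  moreover have "homeomorphic_map E' F J"
    using hom homeomorphic_maps_sym homeomorphic_maps_imp_map by blast
  ultimately have "homeomorphic_map E' ?D (q \<circ> g \<circ> J)"
    using homeomorphic_map_compose by blast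
  then show "homeomorphic_map E' ?D q"
    by (rule homeomorphic_map_eq) (simp add: gJ)
qed

end

theory Submission
  imports Defs
begin

text \<open>
  A map \<open>f\<close> from the disk to \<open>X\<close> is lifted by pulling \<open>p\<close> back along \<open>f\<close> and refining the
  topology of a path component of the pullback to make it locally path-connected.  This changes
  no paths, so the projection to the disk still has the path-covering property and is a
  homeomorphism by the affirmative answer to the lifting problem; its inverse gives the lift.
  Hence null-homotopic loops have closed lifts, and \<open>p\<close> is injective on the path components of
  the preimage of a small open \<open>U\<close>.  These components are open because \<open>ev\<^sub>1\<close> is a quotient map
  and endpoints of lifts depend continuously on the path.  Finally \<open>p\<close> is open because in a first
  countable, locally path-connected space a convergent sequence can be arranged along a path,
  which lifts.
\<close>

section \<open>Path lifting and path components of preimages\<close>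

lemma path_covering_lift:
  assumes "path_covering E X p" "e \<in> topspace E" "pathin X \<beta>" "\<beta> 0 = p e"
  obtains \<alpha> where "pathin E \<alpha>" "\<alpha> 0 = e" "\<And>t. t \<in> {0..1} \<Longrightarrow> p (\<alpha> t) = \<beta> t"
proof -
  have "pathin X (restrict \<beta> {0..1})"
    using assms(3) unfolding pathin_def by (rule continuous_map_eq) auto
  then have "restrict \<beta> {0..1} \<in> paths_from X (p e)"
    using assms(4) by (simp add: paths_from_def)
  then obtain \<alpha> where \<alpha>: "\<alpha> \<in> paths_from E e"
    and eq: "restrict (p \<circ> \<alpha>) {0..1} = restrict \<beta> {0..1}"
    using assms(1,2) unfolding path_covering_def bij_betw_def by (metis (no_types, lifting) imageE)
  have "p (\<alpha> t) = \<beta> t" if "t \<in> {0..1}" for t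
    using fun_cong[OF eq, of t] that by simp
  then show thesis
    by (rule that[rotated 2]) (use \<alpha> in \<open>auto simp: paths_from_def\<close>)
qed

lemma path_covering_unique:
  assumes "path_covering E X p" "pathin E \<alpha>" "pathin E \<beta>" "\<alpha> 0 = \<beta> 0"
    and eq: "\<And>t. t \<in> {0..1} \<Longrightarrow> p (\<alpha> t) = p (\<beta> t)" and t: "t \<in> {0..1}"
  shows "\<alpha> t = \<beta> t"
proof -
  have *: "restrict \<gamma> {0..1} \<in> paths_from E (\<gamma> 0)" if "pathin E \<gamma>" for \<gamma>
  proof -
    have "pathin E (restrict \<gamma> {0..1})"
      using that unfolding pathin_def by (rule continuous_map_eq) auto
    then show ?thesis by (simp add: paths_from_def)
  qed
  have "inj_on (\<lambda>\<alpha>. restrict (p \<circ> \<alpha>) {0..1}) (paths_from E (\<beta> 0))"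
    using assms(1) path_start_in_topspace[OF assms(3)]
    by (auto simp: path_covering_def bij_betw_def)
  moreover have "restrict (p \<circ> restrict \<alpha> {0..1}) {0..1} = restrict (p \<circ> restrict \<beta> {0..1}) {0..1}"
    using eq by (auto simp: fun_eq_iff)
  ultimately have "restrict \<alpha> {0..1} = restrict \<beta> {0..1}"
    using *[OF assms(2)] *[OF assms(3)] assms(4) by (simp add: inj_on_def)
  then show ?thesis using t by (metis restrict_apply')
qed

text \<open>Frees the verification from the extensional normalisation in \<open>paths_from\<close>:
  lifts are arbitrary \<open>pathin\<close> functions, compared on the unit interval only.\<close>

lemma path_coveringI:
  assumes p: "continuous_map E X p"
    and lift: "\<And>e \<beta>. \<lbrakk>e \<in> topspace E; pathin X \<beta>; \<beta> 0 = p e\<rbrakk> \<Longrightarrow>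
      \<exists>\<alpha>. pathin E \<alpha> \<and> \<alpha> 0 = e \<and> (\<forall>t\<in>{0..1}. p (\<alpha> t) = \<beta> t)"
    and unique: "\<And>\<alpha> \<beta> t. \<lbrakk>pathin E \<alpha>; pathin E \<beta>; \<alpha> 0 = \<beta> 0; \<forall>t\<in>{0..1}. p (\<alpha> t) = p (\<beta> t); t \<in> {0..1}\<rbrakk>
      \<Longrightarrow> \<alpha> t = \<beta> t"
  shows "path_covering E X p"
  unfolding path_covering_def bij_betw_def
proof (intro conjI ballI p)
  fix e assume e: "e \<in> topspace E"
  show "inj_on (\<lambda>\<alpha>. restrict (p \<circ> \<alpha>) {0..1}) (paths_from E e)"
  proof (rule inj_onI)
    fix \<alpha> \<beta> assume \<alpha>: "\<alpha> \<in> paths_from E e" and \<beta>: "\<beta> \<in> paths_from E e"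
      and eq: "restrict (p \<circ> \<alpha>) {0..1} = restrict (p \<circ> \<beta>) {0..1}"
    have "p (\<alpha> t) = p (\<beta> t)" if "t \<in> {0..1}" for t
      using fun_cong[OF eq, of t] that by simp
    then have "\<alpha> t = \<beta> t" if "t \<in> {0..1}" for t
      using unique[of \<alpha> \<beta> t] \<alpha> \<beta> that by (simp add: paths_from_def)
    then show "\<alpha> = \<beta>"
      using \<alpha> \<beta> unfolding paths_from_def by (intro extensionalityI[of _ "{0..1}"]) auto
  qed
  show "(\<lambda>\<alpha>. restrict (p \<circ> \<alpha>) {0..1}) ` paths_from E e = paths_from X (p e)"
  proof (intro equalityI subsetI)
    fix \<beta> assume \<beta>: "\<beta> \<in> paths_from X (p e)"
    then obtain \<alpha> where \<alpha>: "pathin E \<alpha>" "\<alpha> 0 = e" "\<forall>t\<in>{0..1}. p (\<alpha> t) = \<beta> t"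
      using lift[OF e] by (auto simp: paths_from_def)
    have "pathin E (restrict \<alpha> {0..1})"
      using \<alpha>(1) unfolding pathin_def by (rule continuous_map_eq) auto
    then have "restrict \<alpha> {0..1} \<in> paths_from E e"
      using \<alpha> by (simp add: paths_from_def)
    moreover have "restrict (p \<circ> restrict \<alpha> {0..1}) {0..1} = \<beta>"
      using \<alpha>(3) \<beta> by (auto simp: fun_eq_iff paths_from_def extensional_def)
    ultimately show "\<beta> \<in> (\<lambda>\<alpha>. restrict (p \<circ> \<alpha>) {0..1}) ` paths_from E e" by force
  qed (use paths_from_compose[OF p] in blast)
qed

text \<open>The path itself, restricted to the segment, joins the two points.
  \<open>closed_segment\<close> is used because its endpoints may come in either order, so later
  arguments can move forwards or backwards in time.\<close>

lemma path_component_of_path_segment: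
  assumes "pathin X g" "s \<in> {0..1}" "t \<in> {0..1}" "g ` closed_segment s t \<subseteq> U"
  shows "path_component_of (subtopology X U) (g s) (g t)"
proof -
  have "closed_segment s t \<subseteq> {0..1}"
    using assms(2,3) by (auto simp: closed_segment_eq_real_ivl split: if_splits)
  then have "path_connectedin (top_of_set {0..1}) (closed_segment s t)"
    by (simp add: path_connectedin_subtopology path_connectedin_iff_path_connected_real convex_imp_path_connected)
  then have "path_connectedin X (g ` closed_segment s t)"
    using assms(1) path_connectedin_continuous_map_image unfolding pathin_def by blast
  then have "path_connectedin (subtopology X U) (g ` closed_segment s t)"
    using assms(4) by (simp add: path_connectedin_subtopology)
  then show ?thesis
    unfolding path_component_of by blast
qed

text \<open>A lift of a path in \<open>U\<close> automatically stays over \<open>U\<close>.\<close>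

lemma path_component_of_lift:
  assumes p: "path_covering E X p" and a: "a \<in> topspace E"
    and y: "path_component_of (subtopology X U) (p a) y"
  obtains b where "path_component_of (subtopology E {e \<in> topspace E. p e \<in> U}) a b" "p b = y"
proof -
  obtain g where g: "pathin X g" "\<forall>t\<in>{0..1}. g t \<in> U" "g 0 = p a" "g 1 = y"
    using y unfolding path_component_of_def pathin_subtopology by blast
  then obtain h where h: "pathin E h" "h 0 = a" "\<And>t. t \<in> {0..1} \<Longrightarrow> p (h t) = g t"
    using path_covering_lift[OF p a] by metis
  have "pathin (subtopology E {e \<in> topspace E. p e \<in> U}) h"
    using h g(2) path_image_subset_topspace[OF h(1)] by (auto simp: pathin_subtopology)
  then show thesis
    using h g(4) by (intro that[of "h 1"]) (auto simp: path_component_of_def)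
qed

lemma path_component_of_project:
  assumes "continuous_map E X p"
    and "path_component_of (subtopology E {e \<in> topspace E. p e \<in> U}) a b"
  shows "path_component_of (subtopology X U) (p a) (p b)"
proof -
  obtain g where g: "pathin E g" "\<forall>t\<in>{0..1}. p (g t) \<in> U" "g 0 = a" "g 1 = b"
    using assms(2) unfolding path_component_of_def pathin_subtopology by auto
  then have "pathin (subtopology X U) (p \<circ> g)"
    using assms(1) by (auto simp: pathin_subtopology pathin_compose)
  then show ?thesis using g unfolding path_component_of_def by fastforce
qed

section \<open>The locally path-connected refinement of a topology\<close>

text \<open>This is the topology with the path components of open sets as a basis, the locally
  path-connected coreflection. The pointwise form gives a direct criterion for openness.\<close>

definition lpc_refinement :: "'a topology \<Rightarrow> 'a topology" where
  "lpc_refinement X = topology (\<lambda>W. W \<subseteq> topspace X \<and>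
     (\<forall>w\<in>W. \<exists>N. openin X N \<and> w \<in> N \<and> path_component_of_set (subtopology X N) w \<subseteq> W))"

lemma openin_lpc_refinement:
  "openin (lpc_refinement X) W \<longleftrightarrow> W \<subseteq> topspace X \<and>
     (\<forall>w\<in>W. \<exists>N. openin X N \<and> w \<in> N \<and> path_component_of_set (subtopology X N) w \<subseteq> W)"
proof -
  let ?op = "\<lambda>W. W \<subseteq> topspace X \<and>
     (\<forall>w\<in>W. \<exists>N. openin X N \<and> w \<in> N \<and> path_component_of_set (subtopology X N) w \<subseteq> W)"
  have "?op (S \<inter> T)" if S: "?op S" and T: "?op T" for S T
  proof (intro conjI ballI)
    show "S \<inter> T \<subseteq> topspace X" using S by auto
    fix w assume w: "w \<in> S \<inter> T"
    obtain N1 where N1: "openin X N1" "w \<in> N1" "path_component_of_set (subtopology X N1) w \<subseteq> S"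
      using S w by auto
    obtain N2 where N2: "openin X N2" "w \<in> N2" "path_component_of_set (subtopology X N2) w \<subseteq> T"
      using T w by auto
    have "path_component_of_set (subtopology X (N1 \<inter> N2)) w \<subseteq> S \<inter> T"
      using N1(3) N2(3) path_component_of_mono[of X "N1 \<inter> N2" w _ N1]
        path_component_of_mono[of X "N1 \<inter> N2" w _ N2] by auto
    then show "\<exists>N. openin X N \<and> w \<in> N \<and> path_component_of_set (subtopology X N) w \<subseteq> S \<inter> T"
      using N1 N2 by (intro exI[of _ "N1 \<inter> N2"]) auto
  qed
  moreover have "?op (\<Union>\<K>)" if "\<forall>K\<in>\<K>. ?op K" for \<K>
  proof (intro conjI ballI)
    show "\<Union>\<K> \<subseteq> topspace X" using that by blast
    fix w assume "w \<in> \<Union>\<K>"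
    then obtain K where K: "K \<in> \<K>" "w \<in> K" by blast
    with bspec[OF that K(1)] obtain N where
      "openin X N" "w \<in> N" "path_component_of_set (subtopology X N) w \<subseteq> K" by auto
    then show "\<exists>N. openin X N \<and> w \<in> N \<and> path_component_of_set (subtopology X N) w \<subseteq> \<Union>\<K>"
      using K(1) by (intro exI[of _ N]) auto
  qed
  ultimately have "istopology ?op"
    unfolding istopology_def by presburger
  then show ?thesis
    by (simp add: lpc_refinement_def topology_inverse')
qed

lemma openin_imp_openin_lpc_refinement:
  assumes "openin X W"
  shows "openin (lpc_refinement X) W"
  unfolding openin_lpc_refinement
proof (intro conjI ballI)
  show "W \<subseteq> topspace X" using assms openin_subset by blast
  fix w assume "w \<in> W"
  moreover have "path_component_of_set (subtopology X W) w \<subseteq> W"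
    using path_component_in_topspace by force
  ultimately show "\<exists>N. openin X N \<and> w \<in> N \<and> path_component_of_set (subtopology X N) w \<subseteq> W"
    using assms by blast
qed

lemma topspace_lpc_refinement [simp]: "topspace (lpc_refinement X) = topspace X"
proof
  show "topspace (lpc_refinement X) \<subseteq> topspace X"
    using openin_lpc_refinement openin_topspace by metis
  show "topspace X \<subseteq> topspace (lpc_refinement X)"
    by (simp add: openin_imp_openin_lpc_refinement openin_subset)
qed

lemma continuous_map_lpc_refinement:
  assumes "continuous_map X Y f"
  shows "continuous_map (lpc_refinement X) Y f"
  using assms by (simp add: continuous_map_def openin_imp_openin_lpc_refinement)

text \<open>Continuity into the finer topology comes for free: if \<open>g\<close> maps an interval
  around \<open>t\<close> into \<open>N\<close>, then \<open>g\<close> itself joins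
  \<open>g t\<close> to every nearby \<open>g s\<close> inside \<open>N\<close>, so these values lie
  in the path component that determines openness.\<close>

lemma pathin_lpc_refinement: "pathin (lpc_refinement X) g \<longleftrightarrow> pathin X g"
proof
  assume "pathin (lpc_refinement X) g"
  then show "pathin X g"
    using pathin_compose[OF _ continuous_map_lpc_refinement[OF continuous_map_id]] by force
next
  assume g: "pathin X g"
  show "pathin (lpc_refinement X) g"
    unfolding pathin_def continuous_map_def
  proof (intro conjI allI impI)
    show "g \<in> topspace (top_of_set {0..1}) \<rightarrow> topspace (lpc_refinement X)"
      using path_image_subset_topspace[OF g] by simp
    fix W assume W: "openin (lpc_refinement X) W"
    show "openin (top_of_set {0..1}) {t \<in> topspace (top_of_set {0..1}). g t \<in> W}"
    proof (subst openin_subopen, intro ballI)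
      fix t assume "t \<in> {t \<in> topspace (top_of_set {0..1}). g t \<in> W}"
      then have t: "t \<in> {0..1}" "g t \<in> W" by auto
      obtain N where N: "openin X N" "g t \<in> N" "path_component_of_set (subtopology X N) (g t) \<subseteq> W"
        using W t(2) unfolding openin_lpc_refinement by blast
      have "openin (top_of_set {0..1}) {s \<in> {0..1}. g s \<in> N}"
        using g N(1) by (auto simp: pathin_def continuous_map_def)
      then obtain d where d: "d > 0" "ball t d \<inter> {0..1} \<subseteq> {s \<in> {0..1}. g s \<in> N}"
        using t N(2) unfolding openin_contains_ball by blast
      have "g s \<in> W" if s: "s \<in> ball t d \<inter> {0..1}" for s
      proof -
        have "closed_segment t s \<subseteq> ball t d \<inter> {0..1}"
          using s t d(1) by (intro closed_segment_subset convex_Int) auto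
        then have "path_component_of (subtopology X N) (g t) (g s)"
          using d(2) s t by (intro path_component_of_path_segment g) auto
        then show ?thesis using N(3) by auto
      qed
      then show "\<exists>T. openin (top_of_set {0..1}) T \<and> t \<in> T \<and>
          T \<subseteq> {t \<in> topspace (top_of_set {0..1}). g t \<in> W}"
        using d(1) t by (intro exI[of _ "ball t d \<inter> {0..1}"]) (auto simp: openin_open)
    qed
  qed
qed

lemma path_component_of_lpc_refinement:
  "path_component_of (subtopology (lpc_refinement X) S) = path_component_of (subtopology X S)"
  by (simp add: fun_eq_iff path_component_of_def pathin_subtopology pathin_lpc_refinement)

text \<open>Both topologies have the same paths, so path components of a set open in the refinement
  may be computed in \<open>X\<close>.\<close>

lemma locally_path_connected_space_lpc_refinement:
  "locally_path_connected_space (lpc_refinement X)"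
  unfolding locally_path_connected_space_eq_open_path_component_of path_component_of_lpc_refinement
proof (intro allI impI)
  fix U x assume "openin (lpc_refinement X) U \<and> x \<in> U"
  then have U: "openin (lpc_refinement X) U" by simp
  show "openin (lpc_refinement X) (path_component_of_set (subtopology X U) x)"
  proof (subst openin_lpc_refinement, intro conjI ballI)
    show "path_component_of_set (subtopology X U) x \<subseteq> topspace X"
      using path_component_in_topspace by fastforce
    fix w assume w: "w \<in> path_component_of_set (subtopology X U) x"
    then have "w \<in> U" using path_component_in_topspace by fastforce
    then obtain N where N: "openin X N" "w \<in> N" "path_component_of_set (subtopology X N) w \<subseteq> U"
      using U unfolding openin_lpc_refinement by blast
    have "path_component_of_set (subtopology X N) w \<subseteq> path_component_of_set (subtopology X U) x"
    proof
      fix z assume "z \<in> path_component_of_set (subtopology X N) w"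
      then obtain g where g: "pathin (subtopology X N) g" "g 0 = w" "g 1 = z"
        by (auto simp: path_component_of_def)
      \<comment> \<open>Each initial piece of \<open>g\<close> shows that \<open>g t\<close> lies in
        the path component of \<open>w\<close> in \<open>N\<close>, which is contained in
        \<open>U\<close>. Hence the whole path stays in \<open>U\<close>, although \<open>N\<close>
        need not.\<close>
      have "g t \<in> U" if t: "t \<in> {0..1}" for t
      proof -
        have "path_component_of (subtopology (subtopology X N) N) (g 0) (g t)"
          using t g(1) path_image_subset_topspace[OF g(1)]
          by (intro path_component_of_path_segment) (auto simp: closed_segment_eq_real_ivl)
        then show ?thesis using N(3) g(2) by (auto simp: subtopology_subtopology)
      qed
      then have "path_component_of (subtopology X U) w z"
        using g by (auto simp: path_component_of_def pathin_subtopology)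
      then show "z \<in> path_component_of_set (subtopology X U) x"
        using w path_component_of_trans by fastforce
    qed
    then show "\<exists>N. openin X N \<and> w \<in> N \<and> path_component_of_set (subtopology X N) w
        \<subseteq> path_component_of_set (subtopology X U) x"
      using N by blast
  qed
qed

section \<open>Lifting maps from the disk and the square\<close>

text \<open>The type in \<open>upl\<close> is that of the points of the pullback, which are pairs of
  a point of the disk and a point of \<open>E\<close>.\<close>

lemma disk_lift:
  fixes E :: "'a topology" and f :: "real^2 \<Rightarrow> 'b"
  assumes upl: "upl_affirmative TYPE((real^2) \<times> 'a)"
    and p: "path_covering E X p"
    and f: "continuous_map (top_of_set (cball 0 1)) X f"
    and d: "d \<in> cball 0 1" and e: "e \<in> topspace E" "p e = f d"
  obtains F where "continuous_map (top_of_set (cball 0 1)) E F" "F d = e"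
    "\<And>z. z \<in> cball 0 1 \<Longrightarrow> p (F z) = f z"
proof -
  let ?D = "top_of_set (cball 0 1) :: (real^2) topology"
  \<comment> \<open>\<open>P\<close> is the pullback of \<open>p\<close> along \<open>f\<close>.
    Passing to the component \<open>C\<close> supplies connectedness, and the refinement supplies
    local path-connectedness, since \<open>C\<close> is open in it.\<close>
  define P where "P = subtopology (prod_topology ?D E) {(z, e). f z = p e}"
  define C where "C = path_component_of_set P (d, e)"
  define T where "T = subtopology (lpc_refinement P) C"
  have topP: "topspace P = {(z, e). z \<in> cball 0 1 \<and> e \<in> topspace E \<and> f z = p e}"
    by (auto simp: P_def)
  have de: "(d, e) \<in> topspace P" using d e by (simp add: topP)
  have CP: "C \<subseteq> topspace P" unfolding C_def by (rule path_component_of_subset_topspace)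
  have topT: "topspace T = C" using CP by (auto simp: T_def)
  have deC: "(d, e) \<in> C" using de by (simp add: C_def path_component_of_refl)
  have pc: "path_component_of_set (lpc_refinement P) (d, e) = C"
    using path_component_of_lpc_refinement[of P "topspace P"] unfolding C_def
    by (metis subtopology_topspace topspace_lpc_refinement)
  have pcT: "path_connected_space T"
    using path_connectedin_path_component_of[of "lpc_refinement P" "(d, e)"]
    unfolding pc path_connectedin_def T_def by simp
  have "openin (lpc_refinement P) C"
    using openin_path_component_of_locally_path_connected_space[OF locally_path_connected_space_lpc_refinement, of P "(d, e)"]
    by (simp add: pc)
  then have lpc: "locally_path_connected_space T"
    unfolding T_def
    by (intro locally_path_connected_space_open_subset locally_path_connected_space_lpc_refinement)
  have pathT: "pathin T g \<longleftrightarrow> pathin P g \<and> (\<forall>t\<in>{0..1}. g t \<in> C)" for g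
    by (simp add: T_def pathin_subtopology pathin_lpc_refinement)
  have pathP: "pathin P g \<longleftrightarrow> pathin ?D (fst \<circ> g) \<and> pathin E (snd \<circ> g) \<and> (\<forall>t\<in>{0..1}. f (fst (g t)) = p (snd (g t)))" for g
    by (auto simp: P_def pathin_subtopology) (auto simp: pathin_def continuous_map_pairwise split: prod.splits)
  have contP: "continuous_map T P id"
    unfolding T_def by (intro continuous_map_from_subtopology continuous_map_lpc_refinement) simp
  have fstP: "continuous_map P ?D fst" and sndP: "continuous_map P E snd"
    unfolding P_def by (auto intro: continuous_map_from_subtopology continuous_map_fst continuous_map_snd)
  have fstT: "continuous_map T ?D fst" and sndT: "continuous_map T E snd"
    using continuous_map_compose[OF contP fstP] continuous_map_compose[OF contP sndP] by auto
  have "path_covering T ?D fst"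
  proof (rule path_coveringI[OF fstT])
    fix c \<beta> assume c: "c \<in> topspace T" and \<beta>: "pathin ?D \<beta>" "\<beta> 0 = fst c"
    have cP: "c \<in> topspace P" using c CP topT by auto
    have "pathin X (f \<circ> \<beta>)" using \<beta>(1) f pathin_compose by blast
    moreover have "(f \<circ> \<beta>) 0 = p (snd c)" "snd c \<in> topspace E" using cP \<beta>(2) by (auto simp: topP)
    ultimately obtain \<alpha> where \<alpha>: "pathin E \<alpha>" "\<alpha> 0 = snd c" "\<And>t. t \<in> {0..1} \<Longrightarrow> p (\<alpha> t) = f (\<beta> t)"
      using path_covering_lift[OF p, of "snd c" "f \<circ> \<beta>"] by auto
    \<comment> \<open>The lift to the pullback pairs \<beta> with a lift of
      \<open>f \<circ> \<beta>\<close> to \<open>E\<close>. It stays in \<open>C\<close> because it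
      starts there.\<close>
    let ?g = "\<lambda>t. (\<beta> t, \<alpha> t)"
    have g: "pathin P ?g" using \<alpha> \<beta> by (auto simp: pathP o_def)
    have "?g t \<in> C" if t: "t \<in> {0..1}" for t
    proof -
      have "path_component_of (subtopology P (topspace P)) (?g 0) (?g t)"
        using t path_image_subset_topspace[OF g]
        by (intro path_component_of_path_segment g) (auto simp: closed_segment_eq_real_ivl)
      moreover have "?g 0 = c" using \<alpha> \<beta> by (simp add: prod_eq_iff)
      ultimately have "path_component_of P c (?g t)" by simp
      moreover have "path_component_of P (d, e) c" using c topT by (simp add: C_def)
      ultimately show ?thesis unfolding C_def by (metis mem_Collect_eq path_component_of_trans)
    qed
    then show "\<exists>\<alpha>. pathin T \<alpha> \<and> \<alpha> 0 = c \<and> (\<forall>t\<in>{0..1}. fst (\<alpha> t) = \<beta> t)"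
      using g \<alpha> \<beta> by (intro exI[of _ ?g]) (auto simp: pathT prod_eq_iff)
  next
    fix \<alpha> \<beta> and t :: real
    assume \<alpha>: "pathin T \<alpha>" and \<beta>: "pathin T \<beta>" and 0: "\<alpha> 0 = \<beta> 0"
      and eq: "\<forall>t\<in>{0..1}. fst (\<alpha> t) = fst (\<beta> t)" and t: "t \<in> {0..1}"
    \<comment> \<open>The first coordinates agree by assumption, so the second coordinates lift the
      same path of \<open>X\<close> from the same point.\<close>
    have "(snd \<circ> \<alpha>) t = (snd \<circ> \<beta>) t"
    proof (rule path_covering_unique[OF p])
      show "pathin E (snd \<circ> \<alpha>)" "pathin E (snd \<circ> \<beta>)"
        using \<alpha> \<beta> by (simp_all add: pathT pathP)
      show "p ((snd \<circ> \<alpha>) s) = p ((snd \<circ> \<beta>) s)" if "s \<in> {0..1}" for s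
        using that \<alpha> \<beta> eq by (auto simp: pathT pathP)
    qed (use 0 t in auto)
    then show "\<alpha> t = \<beta> t" using eq t by (simp add: prod_eq_iff)
  qed
  moreover have "topspace T \<noteq> {}" using deC topT by auto
  ultimately have "homeomorphic_map T ?D fst"
    using upl lpc path_connected_imp_connected_space[OF pcT] unfolding upl_affirmative_def by blast
  then obtain s where s: "homeomorphic_maps T ?D fst s"
    using homeomorphic_map_maps by blast
  show thesis
  proof (rule that[of "snd \<circ> s"])
    show "continuous_map ?D E (snd \<circ> s)"
      using s sndT continuous_map_compose unfolding homeomorphic_maps_def by blast
    \<comment> \<open>The component was taken through \<open>(d, e)\<close>, so this point belongs
      to \<open>T\<close> and the inverse of the first projection returns it.\<close>
    have "s d = (d, e)" using s deC topT unfolding homeomorphic_maps_def by force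
    then show "(snd \<circ> s) d = e" by simp
    fix z :: "real^2" assume z: "z \<in> cball 0 1"
    have "fst (s z) = z" using s z unfolding homeomorphic_maps_def by auto
    moreover have "s z \<in> C" 
      using s z topT unfolding homeomorphic_maps_def continuous_map_def by auto
    ultimately show "p ((snd \<circ> s) z) = f z"
      using CP by (auto simp: topP split: prod.splits)
  qed
qed

text \<open>Transfers \<open>disk_lift\<close> to the domain of path homotopies: the disk and the
  square are compact convex sets of the same dimension, hence homeomorphic.\<close>

lemma square_lift:
  fixes E :: "'a topology" and f :: "real \<times> real \<Rightarrow> 'b"
  assumes upl: "upl_affirmative TYPE((real^2) \<times> 'a)"
    and p: "path_covering E X p"
    and f: "continuous_map (top_of_set ({0..1} \<times> {0..1})) X f"
    and e: "e \<in> topspace E" "p e = f (0, 0)"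
  obtains F where "continuous_map (top_of_set ({0..1} \<times> {0..1})) E F" "F (0, 0) = e"
    "\<And>z. z \<in> {0..1} \<times> {0..1} \<Longrightarrow> p (F z) = f z"
proof -
  let ?S = "{0..1} \<times> {0..1} :: (real \<times> real) set" and ?D = "cball 0 1 :: (real^2) set"
  have "aff_dim ?S = DIM(real \<times> real)"
    by (rule aff_dim_nonempty_interior) (simp add: interior_Times)
  then have "aff_dim ?D = aff_dim ?S" by (simp add: aff_dim_cball)
  then have "?D homeomorphic ?S"
    by (intro homeomorphic_convex_compact_sets)
      (auto intro: convex_Times compact_Times)
  then obtain h k where hk: "homeomorphism ?D ?S h k" unfolding homeomorphic_def by blast
  have h: "continuous_map (top_of_set ?D) (top_of_set ?S) h"
    and k: "continuous_map (top_of_set ?S) (top_of_set ?D) k"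
    using hk unfolding homeomorphism_def continuous_map_in_subtopology by auto
  have hk': "h (k z) = z" and kS: "k z \<in> ?D" if "z \<in> ?S" for z
    using hk that unfolding homeomorphism_def by blast+
  have 0: "(0, 0) \<in> ?S" by simp
  obtain F where F: "continuous_map (top_of_set ?D) E F" "F (k (0, 0)) = e"
      "\<And>z. z \<in> ?D \<Longrightarrow> p (F z) = (f \<circ> h) z"
    using disk_lift[OF upl p continuous_map_compose[OF h f] kS[OF 0] e(1)] e(2) hk'[OF 0]
    by (metis comp_apply)
  show thesis
  proof (rule that[of "F \<circ> k"])
    show "continuous_map (top_of_set ?S) E (F \<circ> k)" using k F(1) continuous_map_compose by blast
    show "(F \<circ> k) (0, 0) = e" using F(2) by simp
    show "p ((F \<circ> k) z) = f z" if "z \<in> ?S" for z using F(3)[OF kS[OF that]] hk'[OF that] by simp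
  qed
qed

section \<open>Closed lifts and injectivity on path components\<close>

text \<open>Lift the homotopy square starting at \<open>g 0\<close>. The edge at homotopy time 0 is
  \<open>g\<close> by uniqueness; the other three edges lie over \<open>x\<close> and are therefore
  constant. Going round them identifies the two ends of \<open>g\<close>.\<close>

lemma nullhomotopic_loop_lift:
  fixes E :: "'a topology"
  assumes upl: "upl_affirmative TYPE((real^2) \<times> 'a)"
    and p: "path_covering E X p" and g: "pathin E g"
    and hom: "homotopic_with (\<lambda>\<beta>. \<beta> 0 = x \<and> \<beta> 1 = x) (top_of_set {0..1}) X (p \<circ> g) (\<lambda>t. x)"
  shows "g 0 = g 1"
proof -
  let ?S = "{0..1} \<times> {0..1} :: (real \<times> real) set"
  obtain h where h: "continuous_map (top_of_set ?S) X h"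
    and h0: "\<And>t. h (0, t) = p (g t)" and h1: "\<And>t. h (1, t) = x"
    and hx: "\<And>s. s \<in> {0..1} \<Longrightarrow> h (s, 0) = x \<and> h (s, 1) = x"
    using hom unfolding homotopic_with_def by (auto simp: prod_topology_subtopology_eu)
  obtain F where F: "continuous_map (top_of_set ?S) E F" "F (0, 0) = g 0"
      "\<And>z. z \<in> ?S \<Longrightarrow> p (F z) = h z"
    using square_lift[OF upl p h path_start_in_topspace[OF g]] h0 by metis
  have vert: "pathin E (\<lambda>t. F (s, t))" and horz: "pathin E (\<lambda>t. F (t, s))" if "s \<in> {0..1}" for s
  proof -
    have "continuous_map (top_of_set {0..1}) (top_of_set ?S) (Pair s)"
      "continuous_map (top_of_set {0..1}) (top_of_set ?S) (\<lambda>t. (t, s))"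
      using that by (auto simp: continuous_map_in_subtopology intro!: continuous_intros)
    then show "pathin E (\<lambda>t. F (s, t))" "pathin E (\<lambda>t. F (t, s))"
      using continuous_map_compose[OF _ F(1)] unfolding pathin_def o_def by blast+
  qed
  have inE: "F z \<in> topspace E" if "z \<in> ?S" for z
    using F(1) that unfolding continuous_map_def by auto
  \<comment> \<open>A path over a single point is compared with the constant path, which has the
    same projection.\<close>
  have const: "\<gamma> 1 = \<gamma> 0" if "pathin E \<gamma>" "\<And>t. t \<in> {0..1} \<Longrightarrow> p (\<gamma> t) = x" for \<gamma>
    using path_covering_unique[OF p that(1), of "\<lambda>_. \<gamma> 0" 1] that path_start_in_topspace[OF that(1)]
    by simp
  have "F (0, 1) = g 1"
    using path_covering_unique[OF p vert[of 0] g, of 1] F h0 by simp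
  moreover have "F (1, 0) = F (0, 0)"
    using const[OF horz[of 0]] F hx by simp
  moreover have "F (1, 1) = F (1, 0)"
    using const[OF vert[of 1]] F h1 by simp
  moreover have "F (1, 1) = F (0, 1)"
    using const[OF horz[of 1]] F hx by simp
  ultimately show ?thesis using F(2) by simp
qed

text \<open>Transporting the two points to the fibre over the base point \<open>x\<close> along lifts of one path
  in \<open>U\<close> avoids conjugating loops.\<close>

lemma inj_on_path_component_over:
  fixes E :: "'a topology"
  assumes upl: "upl_affirmative TYPE((real^2) \<times> 'a)"
    and p: "path_covering E X p"
    and U: "path_connectedin X U" "x \<in> U"
    and null: "\<And>\<alpha>. \<lbrakk>pathin (subtopology X U) \<alpha>; \<alpha> 0 = x; \<alpha> 1 = x\<rbrakk> \<Longrightarrow>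
      homotopic_with (\<lambda>\<beta>. \<beta> 0 = x \<and> \<beta> 1 = x) (top_of_set {0..1}) X \<alpha> (\<lambda>t. x)"
    and bc: "path_component_of (subtopology E {e \<in> topspace E. p e \<in> U}) b c" and eq: "p b = p c"
  shows "b = c"
proof -
  let ?EU = "subtopology E {e \<in> topspace E. p e \<in> U}"
  have b: "b \<in> topspace E" "p b \<in> U" and c: "c \<in> topspace E"
    using path_component_in_topspace[OF bc] by auto
  obtain g where g: "pathin X g" "g \<in> {0..1} \<rightarrow> U" "g 0 = p b" "g 1 = x"
    using U b unfolding path_connectedin by meson
  \<comment> \<open>Every point of the fibre of \<open>p b\<close> is moved along a lift of
    \<open>g\<close> to a point over \<open>x\<close>, without leaving its component over
    \<open>U\<close>.\<close>
  have transport: "\<exists>h. pathin E h \<and> h 0 = a \<and> (\<forall>t\<in>{0..1}. p (h t) = g t) \<and>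
      path_component_of ?EU a (h 1)" if a: "a \<in> topspace E" "p a = p b" for a
  proof -
    obtain h where h: "pathin E h" "h 0 = a" "\<And>t. t \<in> {0..1} \<Longrightarrow> p (h t) = g t"
      using path_covering_lift[OF p a(1) g(1)] g(3) a(2) by metis
    have "pathin ?EU h"
      using h g(2) path_image_subset_topspace[OF h(1)] by (auto simp: pathin_subtopology Pi_iff)
    then show ?thesis using h unfolding path_component_of_def by blast
  qed
  obtain h where h: "pathin E h" "h 0 = b" "\<forall>t\<in>{0..1}. p (h t) = g t" "path_component_of ?EU b (h 1)"
    using transport b by blast
  obtain k where k: "pathin E k" "k 0 = c" "\<forall>t\<in>{0..1}. p (k t) = g t" "path_component_of ?EU c (k 1)"
    using transport c eq by metis
  have "path_component_of ?EU (h 1) (k 1)"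
    by (rule path_component_of_trans[OF path_component_of_trans[OF
          path_component_of_sym[OF h(4)] bc] k(4)])
  then obtain r where r: "pathin ?EU r" "r 0 = h 1" "r 1 = k 1"
    unfolding path_component_of_def by blast
  then have rE: "pathin E r" and "pathin (subtopology X U) (p \<circ> r)"
    using p pathin_compose[of E r X p] by (auto simp: pathin_subtopology path_covering_def)
  \<comment> \<open>\<open>p \<circ> r\<close> is a loop at \<open>x\<close> inside
    \<open>U\<close>, so it is null-homotopic by \<open>null\<close>.\<close>
  then have "r 0 = r 1"
    by (intro nullhomotopic_loop_lift[OF upl p rE, of x] null) (use r h(3) k(3) g(4) in auto)
  have rev: "pathin E (\<lambda>t. f (1 - t))" if "pathin E f" for f
  proof -
    have "continuous_map (top_of_set {0..1}) (top_of_set {0..1}) (\<lambda>t. 1 - t :: real)"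
      by (auto simp: continuous_map_in_subtopology intro!: continuous_intros)
    then show ?thesis
      using continuous_map_compose that unfolding pathin_def o_def by blast
  qed
  \<comment> \<open>Now \<open>h\<close> and \<open>k\<close> end at the same point. Run backwards,
    they are lifts of the same path from one starting point; time 1 of the reversed paths is time 0
    of the original ones.\<close>
  have "h (1 - 1) = k (1 - 1)"
    using path_covering_unique[OF p rev[OF h(1)] rev[OF k(1)], of 1] \<open>r 0 = r 1\<close> r h(3) k(3)
    by simp
  then show ?thesis using h(2) k(2) by simp
qed

section \<open>The path space and openness of path components\<close>

lemma topspace_path_space: "topspace (path_space X x) = paths_from X x"
proof
  show "topspace (path_space X x) \<subseteq> paths_from X x"
    by (auto simp: path_space_def)
  \<comment> \<open>For \<open>K = {}\<close> the condition is void, so the set of all paths is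
    itself subbasic.\<close>
  have "paths_from X x \<in> {{\<alpha> \<in> paths_from X x. \<alpha> ` K \<subseteq> U} | K U. compact K \<and> K \<subseteq> {0..1} \<and> openin X U}"
    by (intro CollectI exI[of _ "{}"] exI[of _ "{}"]) auto
  then show "paths_from X x \<subseteq> topspace (path_space X x)"
    unfolding path_space_def topology_generated_by_topspace by blast
qed

lemma openin_path_space:
  "\<lbrakk>compact K; K \<subseteq> {0..1}; openin X U\<rbrakk> \<Longrightarrow> openin (path_space X x) {\<alpha> \<in> paths_from X x. \<alpha> ` K \<subseteq> U}"
  unfolding path_space_def by (rule topology_generated_by_Basis) blast

text \<open>Induction along \<open>[0,1]\<close>: if the statement holds at time \<open>s\<close> with a set \<open>U\<close> on whose
  preimage \<open>p\<close> is injective on path components, it passes to every time \<open>t\<close> with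
  \<open>p \<circ> \<alpha>\<close> staying in \<open>U\<close> between \<open>s\<close> and \<open>t\<close>.\<close>

lemma nearby_paths_endpoints:
  assumes p: "path_covering E X p" and lpc: "locally_path_connected_space X"
    and inj: "\<And>x. x \<in> topspace X \<Longrightarrow> \<exists>U. openin X U \<and> x \<in> U \<and>
      (\<forall>b c. path_component_of (subtopology E {e \<in> topspace E. p e \<in> U}) b c \<and> p b = p c \<longrightarrow> b = c)"
    and \<alpha>: "\<alpha> \<in> paths_from E e" and t: "t \<in> {0..1}"
    and N: "openin X N" "p (\<alpha> t) \<in> N"
  shows "\<exists>W. openin (path_space E e) W \<and> \<alpha> \<in> W \<and>
    (\<forall>\<beta>\<in>W. path_component_of (subtopology E {e \<in> topspace E. p e \<in> N}) (\<alpha> t) (\<beta> t))"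
proof -
  let ?E = "\<lambda>U. subtopology E {e \<in> topspace E. p e \<in> U}"
  \<comment> \<open>Quantifying over all \<open>N\<close> lets the statement at time
    \<open>s\<close> be used for the injectivity set \<open>U\<close>, while the one at time
    \<open>t\<close> is proved for an arbitrary \<open>N\<close>.\<close>
  define Q where "Q t \<longleftrightarrow> (\<forall>N. openin X N \<and> p (\<alpha> t) \<in> N \<longrightarrow> (\<exists>W. openin (path_space E e) W \<and> \<alpha> \<in> W \<and>
    (\<forall>\<beta>\<in>W. path_component_of (?E N) (\<alpha> t) (\<beta> t))))" for t
  have contp: "continuous_map E X p" using p by (simp add: path_covering_def)
  have pre: "openin E {e \<in> topspace E. p e \<in> U}" if "openin X U" for U
    using contp that by (simp add: continuous_map_def)
  have path\<alpha>: "pathin E \<alpha>" using \<alpha> by (simp add: paths_from_def)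
  have "Q t"
  proof (rule connected_induction_simple[of "{0..1::real}" 0])
    show "Q 0"
      unfolding Q_def
    proof (intro allI impI)
      fix N assume N: "openin X N \<and> p (\<alpha> 0) \<in> N"
      \<comment> \<open>All paths in the path space start at \<open>e\<close>, so the whole space
        serves as \<open>W\<close>.\<close>
      have "path_component_of (?E N) (\<alpha> 0) (\<beta> 0)" if "\<beta> \<in> paths_from E e" for \<beta>
        using that \<alpha> N paths_from_topspace[OF \<alpha>, of 0]
        by (auto simp: paths_from_def path_component_of_refl)
      then show "\<exists>W. openin (path_space E e) W \<and> \<alpha> \<in> W \<and> (\<forall>\<beta>\<in>W. path_component_of (?E N) (\<alpha> 0) (\<beta> 0))"
        using \<alpha> openin_topspace[of "path_space E e"] unfolding topspace_path_space by blast
    qed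
  next
    fix u :: real assume u: "u \<in> {0..1}"
    have "p (\<alpha> u) \<in> topspace X"
      using contp paths_from_topspace[OF \<alpha> u] unfolding continuous_map_def by blast
    then obtain U where U: "openin X U" "p (\<alpha> u) \<in> U"
      and injU: "\<And>b c. \<lbrakk>path_component_of (?E U) b c; p b = p c\<rbrakk> \<Longrightarrow> b = c"
      using inj by metis
    have "openin (top_of_set {0..1}) {s \<in> {0..1}. \<alpha> s \<in> {e \<in> topspace E. p e \<in> U}}"
      using path\<alpha> pre[OF U(1)] unfolding pathin_def continuous_map_def by auto
    then obtain d where d: "d > 0" "{0..1} \<inter> ball u d \<subseteq> {s \<in> {0..1}. \<alpha> s \<in> {e \<in> topspace E. p e \<in> U}}"
      using u U(2) paths_from_topspace[OF \<alpha> u] unfolding openin_contains_ball by blast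
    have "Q t" if s: "s \<in> {0..1} \<inter> ball u d" and t: "t \<in> {0..1} \<inter> ball u d" and "Q s" for s t
      unfolding Q_def
    proof (intro allI impI, elim conjE)
      fix N assume N: "openin X N" "p (\<alpha> t) \<in> N"
      have seg: "closed_segment s t \<subseteq> {0..1} \<inter> ball u d"
        using s t by (intro closed_segment_subset convex_Int) auto
      have \<alpha>seg: "\<alpha> ` closed_segment s t \<subseteq> {e \<in> topspace E. p e \<in> U}"
        using seg d(2) by blast
      \<comment> \<open>Forcing \<open>p (\<beta> t)\<close> into \<open>M\<close> provides a path
        from \<open>p (\<alpha> t)\<close> to it inside both \<open>N\<close> and \<open>U\<close>.
        Local path-connectedness makes \<open>M\<close> open.\<close>
      define M where "M = path_component_of_set (subtopology X (N \<inter> U)) (p (\<alpha> t))"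
      have tNU: "p (\<alpha> t) \<in> N \<inter> U" using N(2) \<alpha>seg by auto
      have M: "openin X M"
        using lpc N(1) U(1) tNU unfolding locally_path_connected_space_eq_open_path_component_of M_def
        by blast
      have tM: "p (\<alpha> t) \<in> M"
        unfolding M_def using tNU openin_subset[OF N(1)] by (auto simp: path_component_of_refl)
      obtain W where W: "openin (path_space E e) W" "\<alpha> \<in> W"
          "\<And>\<beta>. \<beta> \<in> W \<Longrightarrow> path_component_of (?E U) (\<alpha> s) (\<beta> s)"
      proof -
        have "p (\<alpha> s) \<in> U" using \<alpha>seg by auto
        with \<open>Q s\<close> U(1) that show thesis unfolding Q_def by meson
      qed
      \<comment> \<open>Three conditions on \<beta>: it is close to \<alpha> up to time
        \<open>s\<close>, stays over \<open>U\<close> between \<open>s\<close> and \<open>t\<close>,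
        and is over \<open>M\<close> at time \<open>t\<close>.\<close>
      let ?W = "W \<inter> {\<beta> \<in> paths_from E e. \<beta> ` closed_segment s t \<subseteq> {e \<in> topspace E. p e \<in> U}} \<inter>
        {\<beta> \<in> paths_from E e. \<beta> ` {t} \<subseteq> {e \<in> topspace E. p e \<in> M}}"
      have "openin (path_space E e) ?W"
        using seg t M U(1) by (intro openin_Int openin_path_space W pre) auto
      moreover have "\<alpha> \<in> ?W"
        using W(2) \<alpha> \<alpha>seg tM by auto
      moreover have "path_component_of (?E N) (\<alpha> t) (\<beta> t)" if \<beta>: "\<beta> \<in> ?W" for \<beta>
      proof -
        have path\<beta>: "pathin E \<beta>"
          and t\<beta>: "path_component_of (subtopology X (N \<inter> U)) (p (\<alpha> t)) (p (\<beta> t))"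
          using \<beta> by (auto simp: paths_from_def M_def)
        have "\<alpha> t \<in> topspace E" using paths_from_topspace[OF \<alpha>] t by blast
        then obtain b where b: "path_component_of (?E (N \<inter> U)) (\<alpha> t) b" "p b = p (\<beta> t)"
          using path_component_of_lift[OF p _ t\<beta>] by blast
        have bN: "path_component_of (?E N) (\<alpha> t) b" and bU: "path_component_of (?E U) (\<alpha> t) b"
          by (rule path_component_of_mono[OF b(1)]; blast)+
        have \<alpha>st: "path_component_of (?E U) (\<alpha> s) (\<alpha> t)"
          using s t \<alpha>seg by (intro path_component_of_path_segment path\<alpha>) auto
        have \<beta>st: "path_component_of (?E U) (\<beta> s) (\<beta> t)"
          using s t \<beta> by (intro path_component_of_path_segment path\<beta>) auto
        have "path_component_of (?E U) (\<alpha> s) (\<beta> s)" using \<beta> W(3) by blast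
        then have "path_component_of (?E U) (\<alpha> s) (\<beta> t)"
          using \<beta>st by (rule path_component_of_trans)
        \<comment> \<open>Over \<open>U\<close> the chain \<open>b\<close>,
          \<open>\<alpha> t\<close>, \<open>\<alpha> s\<close>, \<open>\<beta> s\<close>,
          \<open>\<beta> t\<close> is connected. As \<open>b\<close> and \<open>\<beta> t\<close>
          have the same image, injectivity identifies them, and \<open>b\<close> was reached from
          \<open>\<alpha> t\<close> over \<open>N\<close>.\<close>
        then have "path_component_of (?E U) b (\<beta> t)"
          by (rule path_component_of_trans[OF path_component_of_sym[OF
                path_component_of_trans[OF \<alpha>st bU]]])
        then have "b = \<beta> t" using injU b(2) by blast
        then show ?thesis using bN by simp
      qed
      ultimately show "\<exists>W. openin (path_space E e) W \<and> \<alpha> \<in> W \<and>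
          (\<forall>\<beta>\<in>W. path_component_of (?E N) (\<alpha> t) (\<beta> t))" by blast
    qed
    then have "\<forall>s\<in>{0..1} \<inter> ball u d. \<forall>t\<in>{0..1} \<inter> ball u d. Q s \<longrightarrow> Q t" by blast
    moreover have "u \<in> {0..1} \<inter> ball u d" using u d(1) by simp
    ultimately show "\<exists>T. openin (top_of_set {0..1}) T \<and> u \<in> T \<and> (\<forall>x\<in>T. \<forall>y\<in>T. Q x \<longrightarrow> Q y)"
      using openin_open_Int[OF open_ball, of "{0..1}" u d] by blast
  qed (use t in auto)
  then show ?thesis using N unfolding Q_def by blast
qed

text \<open>By the quotient map it suffices that the paths ending in \<open>V\<close> form an open
  set, and \<open>nearby_paths_endpoints\<close> at time 1 gives a neighbourhood of each such
  path.\<close>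

lemma openin_path_component_over:
  assumes p: "path_covering E X p" and lpc: "locally_path_connected_space X"
    and inj: "\<And>x. x \<in> topspace X \<Longrightarrow> \<exists>U. openin X U \<and> x \<in> U \<and>
      (\<forall>b c. path_component_of (subtopology E {e \<in> topspace E. p e \<in> U}) b c \<and> p b = p c \<longrightarrow> b = c)"
    and quot: "quotient_map (path_space E e0) E (\<lambda>\<alpha>. \<alpha> 1)"
    and N: "openin X N" and V: "V \<in> path_components_of (subtopology E {e \<in> topspace E. p e \<in> N})"
  shows "openin E V"
proof -
  let ?EN = "subtopology E {e \<in> topspace E. p e \<in> N}"
  obtain v where v: "V = path_component_of_set ?EN v"
    using V by (auto simp: path_components_of_def)
  have "openin (path_space E e0) {\<alpha> \<in> paths_from E e0. \<alpha> 1 \<in> V}"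
  proof (subst openin_subopen, intro ballI)
    fix \<alpha> assume "\<alpha> \<in> {\<alpha> \<in> paths_from E e0. \<alpha> 1 \<in> V}"
    then have \<alpha>: "\<alpha> \<in> paths_from E e0" "path_component_of ?EN v (\<alpha> 1)" by (auto simp: v)
    then have "p (\<alpha> 1) \<in> N" using path_component_in_topspace by fastforce
    then obtain W where W: "openin (path_space E e0) W" "\<alpha> \<in> W"
        "\<forall>\<beta>\<in>W. path_component_of ?EN (\<alpha> 1) (\<beta> 1)"
      using nearby_paths_endpoints[OF p lpc inj \<alpha>(1), of 1 N] N by auto
    have "W \<subseteq> {\<alpha> \<in> paths_from E e0. \<alpha> 1 \<in> V}"
    proof
      fix \<beta> assume \<beta>: "\<beta> \<in> W"
      then have "\<beta> \<in> paths_from E e0"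
        using openin_subset[OF W(1)] by (auto simp: topspace_path_space)
      then show "\<beta> \<in> {\<alpha> \<in> paths_from E e0. \<alpha> 1 \<in> V}"
        using \<alpha>(2) W(3) \<beta> by (auto simp: v intro: path_component_of_trans)
    qed
    then show "\<exists>T. openin (path_space E e0) T \<and> \<alpha> \<in> T \<and> T \<subseteq> {\<alpha> \<in> paths_from E e0. \<alpha> 1 \<in> V}"
      using W by blast
  qed
  moreover have "V \<subseteq> topspace E"
    using path_components_of_subset[OF V] by auto
  ultimately show ?thesis
    using quot unfolding quotient_map_def topspace_path_space by blast
qed

section \<open>Paths through convergent sequences and openness of the map\<close>

lemma first_countable_decreasing_base:
  assumes "first_countable X" "x \<in> topspace X"
  obtains A :: "nat \<Rightarrow> 'a set" where "\<And>n. openin X (A n)" "\<And>n. x \<in> A n" "decseq A"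
    "\<And>U. \<lbrakk>openin X U; x \<in> U\<rbrakk> \<Longrightarrow> \<exists>n. A n \<subseteq> U"
proof -
  obtain \<B> where \<B>: "countable \<B>" "\<And>V. V \<in> \<B> \<Longrightarrow> openin X V"
      "\<And>U. \<lbrakk>openin X U; x \<in> U\<rbrakk> \<Longrightarrow> \<exists>V\<in>\<B>. x \<in> V \<and> V \<subseteq> U"
    using assms unfolding first_countable_def by metis
  define \<C> where "\<C> = {V \<in> \<B>. x \<in> V}"
  have \<C>: "countable \<C>" "\<C> \<noteq> {}"
    using \<B>(1) \<B>(3)[OF openin_topspace assms(2)] by (auto simp: \<C>_def)
  \<comment> \<open>\<open>from_nat_into\<close> enumerates any nonempty countable family, with
    repetitions if it is finite, so no case distinction arises.\<close>
  define A where "A n = (\<Inter>i\<in>{..n}. from_nat_into \<C> i)" for n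
  have mem: "openin X (from_nat_into \<C> i)" "x \<in> from_nat_into \<C> i" for i
    using from_nat_into[OF \<C>(2), of i] \<B>(2) by (auto simp: \<C>_def)
  show thesis
  proof (rule that[of A])
    show "openin X (A n)" for n unfolding A_def by (intro openin_INT2) (auto simp: mem)
    show "x \<in> A n" for n by (simp add: A_def mem)
    show "decseq A" by (auto simp: decseq_def A_def)
    fix U assume "openin X U" "x \<in> U"
    then obtain V where "V \<in> \<C>" "V \<subseteq> U" using \<B>(3) by (auto simp: \<C>_def)
    moreover then have "A (to_nat_on \<C> V) \<subseteq> V" using \<C>(1) by (auto simp: A_def)
    ultimately show "\<exists>n. A n \<subseteq> U" by blast
  qed
qed

text \<open>The n-th path runs during the n-th unit interval. These closed intervals form a locally
  finite cover of the half-line and meet only at integers, where \<open>join\<close> gives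
  agreement.\<close>

lemma continuous_map_chain_of_paths:
  assumes g: "\<And>n. pathin X (g n)" and join: "\<And>n. g n 1 = g (Suc n) 0"
  shows "continuous_map (top_of_set {0..}) X (\<lambda>s. g (nat \<lfloor>s\<rfloor>) (s - of_int \<lfloor>s\<rfloor>))"
proof (rule pasting_lemma_locally_finite[where I = UNIV and T = "\<lambda>n. {real n..real n + 1}"
      and f = "\<lambda>n s. g n (s - real n)"])
  fix x :: real assume "x \<in> topspace (top_of_set {0..})"
  then have x: "x \<ge> 0" by simp
  have "{i. {real i..real i + 1} \<inter> ({0..} \<inter> ball x 1) \<noteq> {}} \<subseteq> {..nat \<lceil>x + 1\<rceil>}"
  proof
    fix i assume "i \<in> {i. {real i..real i + 1} \<inter> ({0..} \<inter> ball x 1) \<noteq> {}}"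
    then obtain y where "real i \<le> y" "dist x y < 1" by auto
    then have "real i \<le> x + 1" by (simp add: dist_real_def)
    then show "i \<in> {..nat \<lceil>x + 1\<rceil>}" by simp linarith
  qed
  then have "finite {i. {real i..real i + 1} \<inter> ({0..} \<inter> ball x 1) \<noteq> {}}"
    using finite_subset by blast
  then show "\<exists>V. openin (top_of_set {0..}) V \<and> x \<in> V \<and> finite {i \<in> UNIV. {real i..real i + 1} \<inter> V \<noteq> {}}"
    using x openin_open_Int[OF open_ball, of "{0..}" x 1]
    by (intro exI[of _ "{0..} \<inter> ball x 1"]) auto
next
  fix i :: nat
  show "closedin (top_of_set {0..}) {real i..real i + 1}"
    by (intro closed_subset) auto
  have "continuous_map (top_of_set {real i..real i + 1}) (top_of_set {0..1}) (\<lambda>s. s - real i)"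
    by (auto simp: continuous_map_in_subtopology intro!: continuous_intros)
  moreover have "{0..} \<inter> {real i..real i + 1} = {real i..real i + 1}" by auto
  ultimately show "continuous_map (subtopology (top_of_set {0..}) {real i..real i + 1}) X (\<lambda>s. g i (s - real i))"
    using continuous_map_compose[OF _ g[unfolded pathin_def], of _ "\<lambda>s. s - real i" i]
    by (simp add: subtopology_subtopology o_def)
next
  fix i j :: nat and x :: real
  have *: "g i (x - real i) = g j (x - real j)" if "i < j" "x \<in> {real i..real i + 1} \<inter> {real j..real j + 1}" for i j
  proof -
    have "x \<le> real i + 1" "real j \<le> x" "real i + 1 \<le> real j" using that by auto
    then have "j = Suc i" "x = real j" by linarith+
    then show ?thesis using join[of i] by simp
  qed
  assume "x \<in> topspace (top_of_set {0..}) \<inter> {real i..real i + 1} \<inter> {real j..real j + 1}"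
  then show "g i (x - real i) = g j (x - real j)"
    using *[of i j] *[of j i] by (metis Int_iff nat_neq_iff)
next
  fix x :: real assume "x \<in> topspace (top_of_set {0..})"
  then have x: "x \<ge> 0" by simp
  have "g (nat \<lfloor>x\<rfloor>) (x - of_int \<lfloor>x\<rfloor>) = g (nat \<lfloor>x\<rfloor>) (x - real (nat \<lfloor>x\<rfloor>))"
    using x by simp
  moreover have "x \<in> {real (nat \<lfloor>x\<rfloor>)..real (nat \<lfloor>x\<rfloor>) + 1}"
    using x of_int_floor_le[of x] real_of_int_floor_add_one_ge[of x] by simp
  ultimately show "\<exists>j. j \<in> UNIV \<and> x \<in> {real j..real j + 1} \<and>
      g (nat \<lfloor>x\<rfloor>) (x - of_int \<lfloor>x\<rfloor>) = g j (x - real j)"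
    by (intro exI[of _ "nat \<lfloor>x\<rfloor>"] conjI UNIV_I)
qed

text \<open>Consecutive points \<open>y n\<close> and \<open>y (Suc n)\<close> can be joined inside
  \<open>A n\<close>, since \<open>A\<close> decreases. The infinite concatenation \<open>G\<close>
  remains in \<open>A n\<close> from time \<open>n\<close> on, so it converges to \<open>x\<close>
  and can be compressed into the unit interval.\<close>

lemma path_through_sequence:
  assumes A: "\<And>n. openin X (A n)" "\<And>n. x \<in> A n" "decseq A"
    and base: "\<And>U. \<lbrakk>openin X U; x \<in> U\<rbrakk> \<Longrightarrow> \<exists>n. A n \<subseteq> U"
    and y: "\<And>n. path_component_of (subtopology X (A n)) x (y n)"
  obtains \<beta> where "pathin X \<beta>" "\<beta> 0 = x" "\<And>n. \<beta> (1 / (real n + 1)) = y n"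
proof -
  have "\<exists>g. pathin (subtopology X (A n)) g \<and> g 0 = y n \<and> g 1 = y (Suc n)" for n
  proof -
    have "path_component_of (subtopology X (A n)) x (y (Suc n))"
      using path_component_of_mono[OF y[of "Suc n"]] \<open>decseq A\<close> by (auto simp: decseq_Suc_iff)
    then have "path_component_of (subtopology X (A n)) (y n) (y (Suc n))"
      by (rule path_component_of_trans[OF path_component_of_sym[OF y]])
    then show ?thesis unfolding path_component_of_def by blast
  qed
  then obtain g where g: "\<And>n. pathin (subtopology X (A n)) (g n)" "\<And>n. g n 0 = y n" "\<And>n. g n 1 = y (Suc n)"
    by metis
  have gA: "g n t \<in> A n" if "t \<in> {0..1}" for n t
    using g(1)[of n] that by (auto simp: pathin_subtopology)
  define G where "G s = g (nat \<lfloor>s\<rfloor>) (s - of_int \<lfloor>s\<rfloor>)" for s :: real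
  have G: "continuous_map (top_of_set {0..}) X G"
    unfolding G_def using g by (intro continuous_map_chain_of_paths) (auto simp: pathin_subtopology)
  have GA: "G s \<in> A n" if "s \<ge> real n" for s n
  proof -
    have "s - of_int \<lfloor>s\<rfloor> \<in> {0..1}"
      using of_int_floor_le[of s] real_of_int_floor_add_one_ge[of s] by (auto simp: algebra_simps)
    then have "G s \<in> A (nat \<lfloor>s\<rfloor>)" unfolding G_def by (rule gA)
    moreover have "n \<le> nat \<lfloor>s\<rfloor>" using that by (simp add: le_nat_floor)
    ultimately show ?thesis using \<open>decseq A\<close> by (auto simp: decseq_def)
  qed
  \<comment> \<open>The substitution sends \<open>1 / (n + 1)\<close> to time \<open>n\<close>, and
    1 to time 0. The limit point \<open>x\<close> is inserted at 0.\<close>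
  define \<beta> where "\<beta> t = (if t = 0 then x else G (1 / t - 1))" for t :: real
  have inX: "G s \<in> topspace X" if "s \<ge> 0" for s
    using G that by (auto simp: continuous_map_def)
  have xX: "x \<in> topspace X" using A openin_subset by blast
  have inv: "continuous_map (top_of_set {0<..1}) (top_of_set {0..}) (\<lambda>t::real. 1 / t - 1)"
    by (auto simp: continuous_map_in_subtopology intro!: continuous_intros)
  have pos: "continuous_map (top_of_set {0<..1}) X \<beta>"
    by (rule continuous_map_eq[OF continuous_map_compose[OF inv G]]) (auto simp: \<beta>_def)
  have "pathin X \<beta>"
    unfolding pathin_def continuous_map_def
  proof (intro conjI allI impI)
    show "\<beta> \<in> topspace (top_of_set {0..1}) \<rightarrow> topspace X"
      using inX xX by (auto simp: \<beta>_def)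
    fix U assume U: "openin X U"
    have "openin (top_of_set {0<..1::real}) {t \<in> {0<..1}. \<beta> t \<in> U}"
      using pos U by (auto simp: continuous_map_def)
    moreover have sub: "{0<..1} = {0..1} \<inter> {0<..<2::real}" by auto
    then have "openin (top_of_set {0..1}) {0<..1::real}"
      using openin_open_Int[of "{0<..<2::real}" "{0..1}"] by simp
    ultimately have op: "openin (top_of_set {0..1}) {t \<in> {0<..1}. \<beta> t \<in> U}"
      by (rule openin_trans)
    show "openin (top_of_set {0..1}) {t \<in> topspace (top_of_set {0..1}). \<beta> t \<in> U}"
    proof (cases "x \<in> U")
      case False
      then have "{t \<in> topspace (top_of_set {0..1}). \<beta> t \<in> U} = {t \<in> {0<..1}. \<beta> t \<in> U}"
        by (auto simp: \<beta>_def order.order_iff_strict)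
      then show ?thesis using op by simp
    next
      case True
      then obtain n where n: "A n \<subseteq> U" using base U by blast
      define d where "d = 1 / (real n + 1)"
      have d: "0 < d" by (simp add: d_def)
      have near: "\<beta> t \<in> U" if "t \<in> {0..1}" "t < d" for t
      proof (cases "t = 0")
        case False
        then have t: "t > 0" using that by simp
        \<comment> \<open>Being close to 0 means being late in the concatenation, hence inside
          \<open>A n\<close>; this is continuity at 0.\<close>
        have "real n \<le> 1 / t - 1"
          using that(2) t by (simp add: d_def field_simps)
        then show ?thesis using GA n False by (auto simp: \<beta>_def)
      qed (simp add: \<beta>_def True)
      have "{t \<in> topspace (top_of_set {0..1}). \<beta> t \<in> U} = {t \<in> {0<..1}. \<beta> t \<in> U} \<union> ({0..1} \<inter> {..<d})"
        using near d by force
      then show ?thesis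
        using op openin_open_Int[of "{..<d}" "{0..1}"] by (simp add: openin_Un)
    qed
  qed
  moreover have "\<beta> (1 / (real n + 1)) = y n" for n
    using g(2) by (simp add: \<beta>_def G_def)
  ultimately show thesis using that[of \<beta>] by (simp add: \<beta>_def)
qed

text \<open>If \<open>p ` W\<close> missed points arbitrarily close to \<open>p e\<close>, a path through a sequence of
  such points converging to \<open>p e\<close> would lift to a path starting at \<open>e\<close> and hence enter \<open>W\<close>.\<close>

lemma path_covering_imp_open_map:
  assumes p: "path_covering E X p" and fc: "first_countable X" and lpc: "locally_path_connected_space X"
  shows "open_map E X p"
  unfolding open_map_def
proof (intro allI impI)
  fix W assume W: "openin E W"
  show "openin X (p ` W)"
  proof (subst openin_subopen, intro ballI, rule ccontr)
    fix x assume "x \<in> p ` W" and no: "\<nexists>T. openin X T \<and> x \<in> T \<and> T \<subseteq> p ` W"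
    then obtain e where e: "e \<in> W" "x = p e" by blast
    have eE: "e \<in> topspace E" using e W openin_subset by blast
    then have xX: "x \<in> topspace X" using p e(2) unfolding path_covering_def continuous_map_def by auto
    obtain A :: "nat \<Rightarrow> _ set" where A: "\<And>n. openin X (A n)" "\<And>n. x \<in> A n" "decseq A"
        "\<And>U. \<lbrakk>openin X U; x \<in> U\<rbrakk> \<Longrightarrow> \<exists>n. A n \<subseteq> U"
      using first_countable_decreasing_base[OF fc xX] by metis
    have "\<exists>y. path_component_of (subtopology X (A n)) x y \<and> y \<notin> p ` W" for n
    proof -
      have "openin X (path_component_of_set (subtopology X (A n)) x)"
        using lpc A(1,2) unfolding locally_path_connected_space_eq_open_path_component_of by blast
      moreover have "x \<in> path_component_of_set (subtopology X (A n)) x"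
        using A(2) xX by (simp add: path_component_of_refl)
      ultimately show ?thesis using no by blast
    qed
    then obtain y where y: "\<And>n. path_component_of (subtopology X (A n)) x (y n)" "\<And>n. y n \<notin> p ` W"
      by metis
    obtain \<beta> where \<beta>: "pathin X \<beta>" "\<beta> 0 = x" "\<And>n. \<beta> (1 / (real n + 1)) = y n"
      using path_through_sequence[OF A y(1)] by blast
    obtain \<alpha> where \<alpha>: "pathin E \<alpha>" "\<alpha> 0 = e" "\<And>t. t \<in> {0..1} \<Longrightarrow> p (\<alpha> t) = \<beta> t"
      using path_covering_lift[OF p eE \<beta>(1)] \<beta>(2) e(2) by metis
    have op: "openin (top_of_set {0..1}) {t \<in> {0..1}. \<alpha> t \<in> W}"
      using \<alpha>(1) W by (auto simp: pathin_def continuous_map_def)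
    obtain d where d: "d > 0" "ball 0 d \<inter> {0..1} \<subseteq> {t \<in> {0..1}. \<alpha> t \<in> W}"
    proof -
      have "0 \<in> {t \<in> {0..1}. \<alpha> t \<in> W}" using \<alpha>(2) e(1) by simp
      with op obtain d where "d > 0" "ball 0 d \<inter> {0..1} \<subseteq> {t \<in> {0..1}. \<alpha> t \<in> W}"
        unfolding openin_contains_ball by blast
      then show thesis by (rule that)
    qed
    obtain n where "inverse (real (Suc n)) < d" using reals_Archimedean[OF d(1)] by blast
    then have n: "1 / (real n + 1) \<in> ball 0 d \<inter> {0..1}"
      by (auto simp: field_simps)
    then have "\<alpha> (1 / (real n + 1)) \<in> W" using d(2) by blast
    moreover have "p (\<alpha> (1 / (real n + 1))) = y n" using \<alpha>(3) \<beta>(3) n by simp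
    ultimately show False using y(2)[of n] by (metis imageI)
  qed
qed

section \<open>Evenly covered neighbourhoods\<close>

theorem corollary4p10:
  fixes E :: "'a topology" and X :: "'b topology" and p :: "'a \<Rightarrow> 'b" and e\<^sub>0 :: 'a
  assumes "upl_affirmative TYPE(real \<Rightarrow> real^2)"
    and "topspace E \<noteq> {}" and "path_connected_space E"
    and "topspace X \<noteq> {}" and "path_connected_space X"
    and "e\<^sub>0 \<in> topspace E"
    and "path_covering E X p"
    and "first_countable X" and "locally_path_connected_space X"
    and "semilocally_simply_connected X"
    and "quotient_map (path_space E e\<^sub>0) E (\<lambda>\<alpha>. \<alpha> 1)"
  shows "covering_projection E X p"
proof -
  note p = \<open>path_covering E X p\<close> and lpc = \<open>locally_path_connected_space X\<close>
  let ?E = "\<lambda>U. subtopology E {e \<in> topspace E. p e \<in> U}"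
  have upl: "upl_affirmative TYPE((real^2) \<times> 'a)"
    using assms(1) by (rule upl_affirmative_any_type)
  have contp: "continuous_map E X p" using p by (simp add: path_covering_def)
  have openp: "open_map E X p" using path_covering_imp_open_map[OF p assms(8) lpc] .
  have nice: "\<exists>U. openin X U \<and> x \<in> U \<and> path_connectedin X U \<and>
      (\<forall>b c. path_component_of (?E U) b c \<and> p b = p c \<longrightarrow> b = c)" if x: "x \<in> topspace X" for x
  proof -
    obtain U\<^sub>0 where U\<^sub>0: "openin X U\<^sub>0" "x \<in> U\<^sub>0"
      "\<And>\<alpha>. \<lbrakk>pathin (subtopology X U\<^sub>0) \<alpha>; \<alpha> 0 = x; \<alpha> 1 = x\<rbrakk> \<Longrightarrow>
        homotopic_with (\<lambda>\<beta>. \<beta> 0 = x \<and> \<beta> 1 = x) (top_of_set {0..1}) X \<alpha> (\<lambda>t. x)"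
      using bspec[OF assms(10)[unfolded semilocally_simply_connected_def] x] by auto
    \<comment> \<open>Semilocal simple connectedness passes to smaller neighbourhoods, so
      \<open>U\<^sub>0\<close> may be replaced by the path component of \<open>x\<close> in it,
      which is open and path-connected.\<close>
    let ?U = "path_component_of_set (subtopology X U\<^sub>0) x"
    have U: "openin X ?U" "path_connectedin X ?U" "?U \<subseteq> U\<^sub>0" "x \<in> ?U"
      using lpc U\<^sub>0(1,2) path_connectedin_path_component_of[of "subtopology X U\<^sub>0" x] x
      by (auto simp: locally_path_connected_space_eq_open_path_component_of
          path_connectedin_subtopology path_component_of_refl)
    have "b = c" if "path_component_of (?E ?U) b c" "p b = p c" for b c
    proof (rule inj_on_path_component_over[OF upl p U(2,4) _ that])
      fix \<alpha> assume "pathin (subtopology X ?U) \<alpha>" "\<alpha> 0 = x" "\<alpha> 1 = x"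
      moreover then have "pathin (subtopology X U\<^sub>0) \<alpha>"
        using U(3) unfolding pathin_subtopology by blast
      ultimately show "homotopic_with (\<lambda>\<beta>. \<beta> 0 = x \<and> \<beta> 1 = x) (top_of_set {0..1}) X \<alpha> (\<lambda>t. x)"
        using U\<^sub>0(3) by blast
    qed
    then show ?thesis using U by blast
  qed
  show ?thesis
    unfolding covering_projection_def
  proof (intro conjI ballI contp)
    show "p ` topspace E = topspace X"
    proof
      show "p ` topspace E \<subseteq> topspace X" using contp by (auto simp: continuous_map_def)
      show "topspace X \<subseteq> p ` topspace E"
      proof
        fix y assume "y \<in> topspace X"
        \<comment> \<open>Surjectivity: lift a path from \<open>p e\<^sub>0\<close> to
          \<open>y\<close>. The trivial subtopology only matches the form of
          \<open>path_component_of_lift\<close>.\<close>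
        then have "path_component_of (subtopology X (topspace X)) (p e\<^sub>0) y"
          using assms(5,6) contp
          by (auto simp: path_connected_space_iff_path_component continuous_map_def)
        then obtain b where "path_component_of (?E (topspace X)) e\<^sub>0 b" "p b = y"
          using path_component_of_lift[OF p assms(6)] by blast
        then show "y \<in> p ` topspace E"
          using path_component_in_topspace by fastforce
      qed
    qed
    fix x assume x: "x \<in> topspace X"
    then obtain U where U: "openin X U" "x \<in> U" "path_connectedin X U"
      and injU: "\<And>b c. \<lbrakk>path_component_of (?E U) b c; p b = p c\<rbrakk> \<Longrightarrow> b = c"
      using nice by metis
    \<comment> \<open>The sheets over \<open>U\<close> are the path components of its
      preimage.\<close>
    let ?\<V> = "path_components_of (?E U)"
    have openV: "openin E V" if "V \<in> ?\<V>" for V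
      using openin_path_component_over[OF p lpc _ assms(11) U(1) that] nice by blast
    have "homeomorphic_map (subtopology E V) (subtopology X U) p" if V: "V \<in> ?\<V>" for V
    proof (rule bijective_open_imp_homeomorphic_map)
      obtain v where v: "V = path_component_of_set (?E U) v" "v \<in> topspace E" "p v \<in> U"
        using V by (auto simp: path_components_of_def)
      have VE: "V \<subseteq> topspace E" and pV: "p ` V \<subseteq> U"
        using path_components_of_subset[OF V] by auto
      show "continuous_map (subtopology E V) (subtopology X U) p"
        using contp pV by (auto simp: continuous_map_in_subtopology continuous_map_from_subtopology)
      show "open_map (subtopology E V) (subtopology X U) p"
        using pV by (intro open_map_into_subtopology open_map_from_subtopology openp openV V) auto
      show "p ` topspace (subtopology E V) = topspace (subtopology X U)"
      proof -
        \<comment> \<open>Each sheet covers all of \<open>U\<close>: a path in \<open>U\<close> from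
          \<open>p v\<close> to \<open>u\<close> lifts to a path that stays in the component of
          \<open>v\<close>.\<close>
        have "u \<in> p ` V" if "u \<in> U" for u
        proof -
          have "path_component_of (subtopology X U) (p v) u"
            using U(3) v(3) that openin_subset[OF U(1)]
            by (auto simp: path_connectedin_def path_connected_space_iff_path_component)
          then obtain b where "path_component_of (?E U) v b" "p b = u"
            using path_component_of_lift[OF p v(2)] by blast
          then show ?thesis using v(1) by blast
        qed
        then have "p ` V = U" using pV by blast
        then show ?thesis using VE openin_subset[OF U(1)] by (simp add: Int_absorb1)
      qed
      show "inj_on p (topspace (subtopology E V))"
      proof (rule inj_onI)
        fix b c assume "b \<in> topspace (subtopology E V)" "c \<in> topspace (subtopology E V)" and eq: "p b = p c"
        then have b: "path_component_of (?E U) v b" and c: "path_component_of (?E U) v c"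
          using v(1) by auto
        have "path_component_of (?E U) b c"
          by (rule path_component_of_trans[OF path_component_of_sym[OF b] c])
        then show "b = c" using injU eq by blast
      qed
    qed
    moreover have "\<Union>?\<V> = {e \<in> topspace E. p e \<in> U}"
      by (auto simp: Union_path_components_of)
    ultimately show "\<exists>U. x \<in> U \<and> openin X U \<and> (\<exists>\<V>. \<Union>\<V> = {e \<in> topspace E. p e \<in> U} \<and>
        (\<forall>V\<in>\<V>. openin E V) \<and> pairwise disjnt \<V> \<and>
        (\<forall>V\<in>\<V>. homeomorphic_map (subtopology E V) (subtopology X U) p))"
      using U openV pairwise_disjoint_path_components_of[of "?E U"]
      by (intro exI[of _ U] conjI exI[of _ ?\<V>]) blast+
  qed
qed

end
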